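(* Let $q$ be a prime power, let $k, L, n$ be integers with $1 \le L \le k$, $n = 2k-L$ and $n \le q-L$, and let $\alpha_1,\dots,\alpha_n,\beta_1,\dots,\beta_L$ be pairwise distinct elements of $\mathbf{F}_q$ (any one of them may be $0$). Then for every $\vec{s} \in \mathbf{F}_q^L$, the advance-sharing encoding procedure and the original encoding procedure (both defined in the context) applied to the quantum secret $|\vec{s}\rangle$ give the same quantum state of the $n$ shares, i.e. $$\left(I \otimes U_{\mathrm{ZM,enc}}\right)\left(|\Psi\rangle \otimes |\vec{s}\rangle\right) = \frac{1}{\sqrt{q^{k-L}}}\sum_{\vec{c}\in D_{\mathrm{ZM}}(\vec{s})} |f_{\vec{c}}(\alpha_1)\rangle \otimes |f_{\vec{c}}(\alpha_2)\rangle \otimes \cdots \otimes |f_{\vec{c}}(\alpha_n)\rangle$$ in $\mathcal{H}_q^{\otimes n}$, where $I$ is the identity on the first $k-L$ qudits of $|\Psi\rangle$ and $U_{\mathrm{ZM,enc}}$ acts on the last $k-L$ qudits of $|\Psi\rangle$ together with the $L$ qudits of $|\vec{s}\rangle$.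
   Context: $\mathbf{F}_q$ is the finite field with $q$ elements. $\mathcal{H}_q$ is a $q$-dimensional complex Hilbert space (a qudit) with orthonormal basis $\{|i\rangle : i \in \mathbf{F}_q\}$. For a vector $\vec{v}=(v_1,\dots,v_m) \in \mathbf{F}_q^m$ write $|\vec{v}\rangle = |v_1\rangle\otimes\cdots\otimes|v_m\rangle \in \mathcal{H}_q^{\otimes m}$. For $\vec{c}=(c_1,\dots,c_k)\in\mathbf{F}_q^k$ let $f_{\vec{c}}(x) = c_1 + c_2 x + \cdots + c_k x^{k-1}$. For $\vec{s}=(s_1,\dots,s_L)\in\mathbf{F}_q^L$ let $D_{\mathrm{ZM}}(\vec{s}) = \{\vec{c}\in\mathbf{F}_q^k : f_{\vec{c}}(\beta_i) = s_i \text{ for } i=1,\dots,L\}$. Original encoding procedure (the strongly secure $(k,L,n)$ ramp quantum secret sharing scheme of Zhang and Matsumoto): the secret $|\vec{s}\rangle$ is encoded into the $n$-qudit state $\frac{1}{\sqrt{q^{k-L}}}\sum_{\vec{c}\in D_{\mathrm{ZM}}(\vec{s})} |f_{\vec{c}}(\alpha_1)\rangle \otimes \cdots \otimes |f_{\vec{c}}(\alpha_n)\rangle$, whose $i$-th qudit is the $i$-th share. Advance-sharing encoding procedure: let $$|\Psi\rangle = \frac{1}{\sqrt{q^{k-L}}}\sum_{\vec{r}\in\mathbf{F}_q^{k-L}} |\vec{r}\rangle\otimes|\vec{r}\rangle \in \mathcal{H}_q^{\otimes 2(k-L)}.$$ For $\vec{r}=(r_1,\dots,r_{k-L})\in\mathbf{F}_q^{k-L}$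 and $\vec{s}\in\mathbf{F}_q^L$, let $h_{\vec{r},\vec{s}}(x)$ be the unique polynomial in $\{f_{\vec{c}}(x) : \vec{c}\in D_{\mathrm{ZM}}(\vec{s})\}$ with $h_{\vec{r},\vec{s}}(\alpha_i) = r_i$ for $i=1,\dots,k-L$. Let $U_{\mathrm{ZM,enc}} : \mathcal{H}_q^{\otimes k} \to \mathcal{H}_q^{\otimes (n-k+L)}$ (note $n-k+L=k$) be the unitary map determined by $|\vec{r}\rangle|\vec{s}\rangle \mapsto |h_{\vec{r},\vec{s}}(\alpha_{k-L+1})\rangle\otimes\cdots\otimes|h_{\vec{r},\vec{s}}(\alpha_n)\rangle$ for all $\vec{r}\in\mathbf{F}_q^{k-L}$, $\vec{s}\in\mathbf{F}_q^L$. The dealer first distributes the first (left) $k-L$ qudits of $|\Psi\rangle$ as shares $1,\dots,k-L$; once $|\vec{s}\rangle$ is given, the dealer applies $U_{\mathrm{ZM,enc}}$ to the remaining $k-L$ qudits of $|\Psi\rangle$ and $|\vec{s}\rangle$, and the resulting $n-k+L$ qudits are shares $k-L+1,\dots,n$. *)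

theory Defs
  imports Complex_Main
    "HOL-Library.FuncSet"
    "HOL-Library.Cardinality"
    "HOL-Computational_Algebra.Polynomial"
begin

text \<open>
  The field with \<open>q\<close> elements is a type \<open>'a :: {field, finite}\<close> with \<open>q = CARD('a)\<close>.
  Vectors of length \<open>m\<close> over it are lists of length \<open>m\<close>; list positions count from \<open>0\<close>, so
  \<open>\<alpha> ! i\<close> is the \<open>(i+1)\<close>-st evaluation point.
\<close>

definition words :: "nat \<Rightarrow> 'a list set" where
  "words m = {v. length v = m}"

text \<open>
  A vector of the \<open>m\<close>-fold tensor power of the \<open>q\<close>-dimensional space is given by its amplitudes
  in the computational basis, which is indexed by \<open>words m\<close>; amplitudes at lists of any other
  length are \<open>0\<close>, so that equality of vectors is equality of functions.
\<close>

type_synonym 'a amp = "'a list \<Rightarrow> complex"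

definition qudits :: "nat \<Rightarrow> 'a amp set" where
  "qudits m = {\<phi>. \<forall>xs. xs \<notin> words m \<longrightarrow> \<phi> xs = 0}"

definition inner_qudits :: "nat \<Rightarrow> 'a amp \<Rightarrow> 'a amp \<Rightarrow> complex" where
  "inner_qudits m \<phi> \<psi> = (\<Sum>v\<in>words m. cnj (\<phi> v) * \<psi> v)"

text \<open>The tensor product of a vector \<open>\<phi>\<close> of \<open>m\<close> qudits with a vector \<open>\<psi>\<close> of any number of qudits.\<close>

definition tensor :: "nat \<Rightarrow> 'a amp \<Rightarrow> 'a amp \<Rightarrow> 'a amp" where
  "tensor m \<phi> \<psi> = (\<lambda>xs. \<phi> (take m xs) * \<psi> (drop m xs))"

definition ket1 :: "'a \<Rightarrow> 'a amp" where
  "ket1 x = (\<lambda>xs. if xs = [x] then 1 else 0)"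

primrec ket :: "'a list \<Rightarrow> 'a amp" where
  "ket [] = (\<lambda>xs. if xs = [] then 1 else 0)"
| "ket (x # v) = tensor 1 (ket1 x) (ket v)"

text \<open>
  Maps are taken extensional (\<open>undefined\<close> off \<open>qudits m\<close>), so that a unitary map is determined
  by its values on \<open>qudits m\<close>.
\<close>

definition unitary_map :: "nat \<Rightarrow> nat \<Rightarrow> ('a amp \<Rightarrow> 'a amp) \<Rightarrow> bool" where
  "unitary_map m m' U \<longleftrightarrow>
     U \<in> qudits m \<rightarrow>\<^sub>E qudits m' \<and>
     (\<forall>\<phi>\<in>qudits m. \<forall>\<psi>\<in>qudits m. \<forall>a b.
        U (\<lambda>xs. a * \<phi> xs + b * \<psi> xs) = (\<lambda>xs. a * U \<phi> xs + b * U \<psi> xs)) \<and>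
     (\<forall>\<phi>\<in>qudits m. \<forall>\<psi>\<in>qudits m. inner_qudits m' (U \<phi>) (U \<psi>) = inner_qudits m \<phi> \<psi>) \<and>
     bij_betw U (qudits m) (qudits m')"

text \<open>
  For linear \<open>A\<close> from \<open>m\<close> to \<open>m'\<close> qudits and linear \<open>B\<close> on \<open>l\<close> qudits, \<open>op_tensor m m' l A B\<close>
  is the linear map with \<open>|u\<rangle> \<otimes> |v\<rangle> \<mapsto> A |u\<rangle> \<otimes> B |v\<rangle>\<close>.
\<close>

definition op_tensor ::
  "nat \<Rightarrow> nat \<Rightarrow> nat \<Rightarrow> ('a amp \<Rightarrow> 'a amp) \<Rightarrow> ('a amp \<Rightarrow> 'a amp) \<Rightarrow> 'a amp \<Rightarrow> 'a amp" where
  "op_tensor m m' l A B \<Phi> =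
     (\<lambda>xs. \<Sum>u\<in>words m. \<Sum>v\<in>words l. \<Phi> (u @ v) * tensor m' (A (ket u)) (B (ket v)) xs)"

text \<open>\<open>Poly c\<close> is the polynomial with coefficient list \<open>c\<close>, constant term first.\<close>

definition D_ZM :: "nat \<Rightarrow> nat \<Rightarrow> 'a::field list \<Rightarrow> 'a list \<Rightarrow> 'a list set" where
  "D_ZM k L \<beta> s = {c \<in> words k. \<forall>i<L. poly (Poly c) (\<beta> ! i) = s ! i}"

definition original_encoding ::
  "nat \<Rightarrow> nat \<Rightarrow> 'a::{field,finite} list \<Rightarrow> 'a list \<Rightarrow> 'a list \<Rightarrow> 'a amp" where
  "original_encoding k L \<alpha> \<beta> s =
     (\<lambda>xs. complex_of_real (1 / sqrt (real (CARD('a) ^ (k - L)))) *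
        (\<Sum>c\<in>D_ZM k L \<beta> s. ket (map (poly (Poly c)) \<alpha>) xs))"

text \<open>The maximally entangled state of \<open>2 * m\<close> qudits.\<close>

definition Psi :: "nat \<Rightarrow> 'a::{field,finite} amp" where
  "Psi m =
     (\<lambda>xs. complex_of_real (1 / sqrt (real (CARD('a) ^ m))) *
        (\<Sum>r\<in>words m. tensor m (ket r) (ket r) xs))"

definition h_poly ::
  "nat \<Rightarrow> nat \<Rightarrow> 'a::field list \<Rightarrow> 'a list \<Rightarrow> 'a list \<Rightarrow> 'a list \<Rightarrow> 'a poly" where
  "h_poly k L \<alpha> \<beta> r s =
     (THE h. h \<in> Poly ` D_ZM k L \<beta> s \<and> (\<forall>i<k - L. poly h (\<alpha> ! i) = r ! i))"

definition U_ZM_enc ::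
  "nat \<Rightarrow> nat \<Rightarrow> nat \<Rightarrow> 'a::field list \<Rightarrow> 'a list \<Rightarrow> 'a amp \<Rightarrow> 'a amp" where
  "U_ZM_enc k L n \<alpha> \<beta> =
     (THE U. unitary_map k (n - k + L) U \<and>
        (\<forall>r\<in>words (k - L). \<forall>s\<in>words L.
           U (tensor (k - L) (ket r) (ket s)) =
             ket (map (poly (h_poly k L \<alpha> \<beta> r s)) (drop (k - L) \<alpha>))))"

definition advance_sharing_encoding ::
  "nat \<Rightarrow> nat \<Rightarrow> nat \<Rightarrow> 'a::{field,finite} list \<Rightarrow> 'a list \<Rightarrow> 'a list \<Rightarrow> 'a amp" where
  "advance_sharing_encoding k L n \<alpha> \<beta> s =
     op_tensor (k - L) (k - L) k id (U_ZM_enc k L n \<alpha> \<beta>)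
       (tensor (2 * (k - L)) (Psi (k - L)) (ket s))"

end

theory Submission
  imports Defs
begin

text \<open>
  Evaluation at \<open>k\<close> distinct points is a permutation of the coefficient vectors in \<open>words k\<close>.
  Evaluating at \<open>\<alpha>\<^sub>1, \<dots>, \<alpha>\<^sub>k\<^sub>-\<^sub>L, \<beta>\<^sub>1, \<dots>, \<beta>\<^sub>L\<close> and at \<open>\<alpha>\<^sub>k\<^sub>-\<^sub>L\<^sub>+\<^sub>1, \<dots>, \<alpha>\<^sub>n\<close> gives two of them,
  and the encoding unitary permutes the basis kets by the second after the inverse of the first.
  Each \<open>c\<close> with \<open>f\<^sub>c(\<beta>\<^sub>i) = s\<^sub>i\<close> is therefore named by \<open>r = (f\<^sub>c(\<alpha>\<^sub>1), \<dots>, f\<^sub>c(\<alpha>\<^sub>k\<^sub>-\<^sub>L))\<close>, and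
  this reindexing carries the sum over \<open>r\<close> to the sum over \<open>c\<close>.
\<close>

section \<open>Kets and unitary maps\<close>

lemma finite_words [simp]: "finite (words m :: 'a::finite list set)"
  using finite_lists_length_eq[OF finite_class.finite_UNIV, of m] by (simp add: words_def)

lemma ket_apply: "ket v xs = (if xs = v then 1 else 0)"
proof (induction v arbitrary: xs)
  case (Cons x v)
  then show ?case by (cases xs) (auto simp: tensor_def ket1_def)
qed simp

lemma ket_in_qudits: "v \<in> words m \<Longrightarrow> ket v \<in> qudits m"
  by (auto simp: qudits_def ket_apply)

lemma tensor_ket_ket:
  assumes "length u = m"
  shows "tensor m (ket u) (ket v) = ket (u @ v)"
proof
  fix xs
  have "xs = u @ v \<longleftrightarrow> take m xs = u \<and> drop m xs = v"
    using assms by (metis append_eq_conv_conj)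
  then show "tensor m (ket u) (ket v) xs = ket (u @ v) xs"
    by (simp add: tensor_def ket_apply)
qed

lemma qudits_sum:
  assumes "finite W" "W \<subseteq> words m"
  shows "(\<lambda>xs. \<Sum>w\<in>W. a w * ket w xs) \<in> qudits m"
  using assms by (auto simp: qudits_def ket_apply intro!: sum.neutral)

lemma qudits_expand:
  fixes \<phi> :: "'a::finite amp"
  assumes "\<phi> \<in> qudits m"
  shows "\<phi> = (\<lambda>xs. \<Sum>w\<in>words m. \<phi> w * ket w xs)"
proof
  show "\<phi> xs = (\<Sum>w\<in>words m. \<phi> w * ket w xs)" for xs
    using assms by (simp add: ket_apply if_distrib sum.delta qudits_def cong: if_cong)
qed

text \<open>\<open>unitary_map\<close> only states linearity for two vectors of
  \<open>qudits m\<close>; induction on \<open>W\<close> extends it to sums of kets,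
  \<open>qudits_sum\<close> keeping each partial sum in that domain.\<close>

lemma unitary_map_sum:
  assumes U: "unitary_map m m' U" and "finite W" "W \<subseteq> words m"
  shows "U (\<lambda>xs. \<Sum>w\<in>W. a w * ket w xs) = (\<lambda>xs. \<Sum>w\<in>W. a w * U (ket w) xs)"
  using assms(2,3)
proof (induction W rule: finite_induct)
  case empty
  have lin: "U (\<lambda>xs. a * \<phi> xs + b * \<psi> xs) = (\<lambda>xs. a * U \<phi> xs + b * U \<psi> xs)"
    if "\<phi> \<in> qudits m" "\<psi> \<in> qudits m" for a b \<phi> \<psi>
    using U that by (simp add: unitary_map_def)
  have "(\<lambda>xs. 0) \<in> qudits m" by (simp add: qudits_def)
  \<comment> \<open>Both coefficients \<open>0\<close> turn linearity into the statement that
    \<open>U\<close> fixes the zero vector.\<close>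
  from lin[OF this this, of 0 0] show ?case by simp
next
  case (insert w W)
  have lin: "U (\<lambda>xs. a * \<phi> xs + b * \<psi> xs) = (\<lambda>xs. a * U \<phi> xs + b * U \<psi> xs)"
    if "\<phi> \<in> qudits m" "\<psi> \<in> qudits m" for a b \<phi> \<psi>
    using U that by (simp add: unitary_map_def)
  have "U (\<lambda>xs. a w * ket w xs + 1 * (\<Sum>w\<in>W. a w * ket w xs))
      = (\<lambda>xs. a w * U (ket w) xs + 1 * U (\<lambda>xs. \<Sum>w\<in>W. a w * ket w xs) xs)"
    using insert by (intro lin ket_in_qudits qudits_sum) auto
  with insert show ?case by simp
qed

text \<open>Kets span \<open>qudits m\<close>, and outside it both maps are \<open>undefined\<close>
  by extensionality. This gives uniqueness for the definite description in
  \<open>U_ZM_enc\<close>.\<close>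

lemma unitary_map_eqI:
  fixes U V :: "'a::finite amp \<Rightarrow> 'a amp"
  assumes U: "unitary_map m m' U" and V: "unitary_map m m' V"
    and eq: "\<And>w. w \<in> words m \<Longrightarrow> U (ket w) = V (ket w)"
  shows "U = V"
proof (rule PiE_ext)
  show "U \<in> qudits m \<rightarrow>\<^sub>E qudits m'" "V \<in> qudits m \<rightarrow>\<^sub>E qudits m'"
    using U V by (auto simp: unitary_map_def)
next
  fix \<phi> :: "'a amp" assume "\<phi> \<in> qudits m"
  note expand = qudits_expand[OF this]
  have "U \<phi> = (\<lambda>xs. \<Sum>w\<in>words m. \<phi> w * U (ket w) xs)"
    by (subst expand, subst unitary_map_sum[OF U]) auto
  also have "\<dots> = (\<lambda>xs. \<Sum>w\<in>words m. \<phi> w * V (ket w) xs)"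
    by (simp add: eq)
  also have "\<dots> = V \<phi>"
    by (subst (2) expand, subst unitary_map_sum[OF V]) auto
  finally show "U \<phi> = V \<phi>" .
qed

section \<open>Unitaries that permute the computational basis\<close>

definition permute_qudits :: "nat \<Rightarrow> ('a list \<Rightarrow> 'a list) \<Rightarrow> 'a amp \<Rightarrow> 'a amp" where
  "permute_qudits m T = (\<lambda>\<phi>\<in>qudits m. \<lambda>xs.
     if xs \<in> words m then \<phi> (inv_into (words m) T xs) else 0)"

text \<open>Amplitudes are pulled back along the inverse of \<open>T\<close>, so pulling back along
  \<open>T\<close> inverts the map, and inner products agree by reindexing the sum over
  \<open>words m\<close>.\<close>

lemma unitary_map_permute_qudits:
  assumes T: "bij_betw T (words m) (words m)"
  shows "unitary_map m m (permute_qudits m T)"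
proof -
  let ?S = "inv_into (words m) T"
  have S: "bij_betw ?S (words m) (words m)"
    using T by (rule bij_betw_inv_into)
  have closed: "permute_qudits m T \<phi> \<in> qudits m" if "\<phi> \<in> qudits m" for \<phi>
    using that by (simp add: permute_qudits_def qudits_def)
  have "bij_betw (permute_qudits m T) (qudits m) (qudits m)"
  proof (rule bij_betw_byWitness[where f' = "\<lambda>\<phi> xs. if xs \<in> words m then \<phi> (T xs) else 0"])
    show "\<forall>\<phi>\<in>qudits m.
        (\<lambda>xs. if xs \<in> words m then permute_qudits m T \<phi> (T xs) else 0) = \<phi>"
      using bij_betw_apply[OF T] bij_betw_inv_into_left[OF T]
      by (fastforce simp: permute_qudits_def qudits_def)
    show "\<forall>\<phi>\<in>qudits m.
        permute_qudits m T (\<lambda>xs. if xs \<in> words m then \<phi> (T xs) else 0) = \<phi>"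
      using bij_betw_apply[OF S] bij_betw_inv_into_right[OF T]
      by (fastforce simp: permute_qudits_def qudits_def)
  qed (use closed in \<open>auto simp: qudits_def\<close>)
  moreover have "inner_qudits m (permute_qudits m T \<phi>) (permute_qudits m T \<psi>) = inner_qudits m \<phi> \<psi>"
    if "\<phi> \<in> qudits m" "\<psi> \<in> qudits m" for \<phi> \<psi>
    using that sum.reindex_bij_betw[OF S, of "\<lambda>v. cnj (\<phi> v) * \<psi> v"]
    by (simp add: inner_qudits_def permute_qudits_def)
  moreover have "permute_qudits m T (\<lambda>xs. a * \<phi> xs + b * \<psi> xs)
      = (\<lambda>xs. a * permute_qudits m T \<phi> xs + b * permute_qudits m T \<psi> xs)"
    if "\<phi> \<in> qudits m" "\<psi> \<in> qudits m" for a b \<phi> \<psi>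
    using that by (auto simp: permute_qudits_def qudits_def)
  moreover have "permute_qudits m T \<in> qudits m \<rightarrow>\<^sub>E qudits m"
    using closed by (auto simp: permute_qudits_def)
  ultimately show ?thesis
    unfolding unitary_map_def by blast
qed

lemma permute_qudits_ket:
  assumes T: "bij_betw T (words m) (words m)" and w: "w \<in> words m"
  shows "permute_qudits m T (ket w) = ket (T w)"
proof
  fix xs
  have "inv_into (words m) T xs = w \<longleftrightarrow> xs = T w" if "xs \<in> words m"
    using that bij_betw_inv_into_left[OF T w] bij_betw_inv_into_right[OF T that] by auto
  then show "permute_qudits m T (ket w) xs = ket (T w) xs"
    using ket_in_qudits[OF w] bij_betw_apply[OF T w] by (auto simp: permute_qudits_def ket_apply)
qed

section \<open>Evaluation of polynomials\<close>

abbreviation evaluate :: "'a::field list \<Rightarrow> 'a list \<Rightarrow> 'a list" where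
  "evaluate xs c \<equiv> map (poly (Poly c)) xs"

text \<open>\<open>Poly\<close> forgets trailing zeros; fixing the length restores
  injectivity.\<close>

lemma Poly_eq_iff_same_length:
  assumes "length c = length d"
  shows "Poly c = Poly d \<longleftrightarrow> c = d"
proof
  assume "Poly c = Poly d"
  then have "nth_default 0 c i = nth_default 0 d i" for i
    by (metis coeff_Poly_eq)
  then show "c = d"
    using assms by (metis nth_default_nth nth_equalityI)
qed simp

text \<open>If two coefficient vectors have the same values, their difference has degree below
  \<open>k\<close> but \<open>k\<close> roots, so it vanishes. An injective self-map of the finite
  set \<open>words k\<close> is onto.\<close>

lemma bij_betw_evaluate:
  fixes xs :: "'a::{field,finite} list"
  assumes "distinct xs" "length xs = k"
  shows "bij_betw (evaluate xs) (words k) (words k)"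
proof -
  have inj: "inj_on (evaluate xs) (words k)"
  proof (rule inj_onI)
    fix c d :: "'a list"
    assume cd: "c \<in> words k" "d \<in> words k" and eq: "evaluate xs c = evaluate xs d"
    have "Poly c = Poly d"
    proof (rule ccontr)
      assume ne: "Poly c \<noteq> Poly d"
      let ?p = "Poly c - Poly d"
      have coeff: "coeff ?p i = 0" if "i \<ge> k" for i
        using cd that by (simp add: words_def coeff_Poly_eq nth_default_beyond)
      have "k > degree ?p"
        using ne coeff[of "degree ?p"] by (metis eq_iff_diff_eq_0 leading_coeff_0_iff not_less)
      moreover have "set xs \<subseteq> {x. poly ?p x = 0}"
        using eq by auto
      then have "k \<le> card {x. poly ?p x = 0}"
        using assms by (metis card_mono distinct_card finite)
      moreover have "card {x. poly ?p x = 0} \<le> degree ?p"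
        using ne by (intro card_poly_roots_bound) simp
      ultimately show False by linarith
    qed
    then show "c = d"
      using cd by (simp add: Poly_eq_iff_same_length words_def)
  qed
  moreover have "evaluate xs ` words k \<subseteq> words k"
    using assms by (auto simp: words_def)
  ultimately show ?thesis
    by (simp add: bij_betw_def endo_inj_surj)
qed

lemma D_ZM_eq:
  assumes "length \<beta> = L" "s \<in> words L"
  shows "D_ZM k L \<beta> s = {c \<in> words k. evaluate \<beta> c = s}"
  using assms by (auto simp: D_ZM_def words_def list_eq_iff_nth_eq)

section \<open>Interpolation points of the scheme and its encoder on basis words\<close>

locale ramp_points =
  fixes k L n :: nat and \<alpha> \<beta> :: "'a::{field,finite} list"
  assumes L_le: "L \<le> k" and n_eq: "n = 2 * k - L"
    and length_alpha: "length \<alpha> = n" and length_beta: "length \<beta> = L"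
    and distinct_points: "distinct (\<alpha> @ \<beta>)"
begin

text \<open>Since \<open>n = 2 * k - L\<close>, both this list and \<open>outputs\<close> consist of
  exactly \<open>k\<close> points, so either one determines a coefficient vector in
  \<open>words k\<close>.\<close>

abbreviation "inputs \<equiv> take (k - L) \<alpha> @ \<beta>"
abbreviation "outputs \<equiv> drop (k - L) \<alpha>"

lemma bij_inputs: "bij_betw (evaluate inputs) (words k) (words k)"
proof (rule bij_betw_evaluate)
  show "distinct inputs"
    using distinct_points set_take_subset[of "k - L" \<alpha>] by auto
  show "length inputs = k"
    using L_le n_eq length_alpha length_beta by simp
qed

lemma bij_outputs: "bij_betw (evaluate outputs) (words k) (words k)"
  using distinct_points L_le n_eq length_alpha by (intro bij_betw_evaluate) auto

definition encode :: "'a list \<Rightarrow> 'a list" where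
  "encode = evaluate outputs \<circ> inv_into (words k) (evaluate inputs)"

lemma bij_encode: "bij_betw encode (words k) (words k)"
  unfolding encode_def
  using bij_betw_inv_into[OF bij_inputs] bij_outputs by (rule bij_betw_trans)

lemma encode_inputs: "c \<in> words k \<Longrightarrow> encode (evaluate inputs c) = evaluate outputs c"
  using bij_betw_inv_into_left[OF bij_inputs] by (simp add: encode_def del: map_append)

lemma append_in_words: "r \<in> words (k - L) \<Longrightarrow> s \<in> words L \<Longrightarrow> r @ s \<in> words k"
  using L_le by (simp add: words_def)

text \<open>On \<open>D_ZM k L \<beta> s\<close> the values at \<open>\<beta>\<close> are fixed to
  \<open>s\<close>, so the first \<open>k - L\<close> shares complete the values at
  \<open>inputs\<close>: they determine \<open>c\<close>, and any \<open>r\<close> occurs by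
  interpolating \<open>r @ s\<close>.\<close>

lemma bij_D_ZM:
  assumes s: "s \<in> words L"
  shows "bij_betw (evaluate (take (k - L) \<alpha>)) (D_ZM k L \<beta> s) (words (k - L))"
  unfolding bij_betw_def
proof (intro conjI inj_onI subset_antisym subsetI)
  fix c d
  assume cd: "c \<in> D_ZM k L \<beta> s" "d \<in> D_ZM k L \<beta> s"
    and eq: "evaluate (take (k - L) \<alpha>) c = evaluate (take (k - L) \<alpha>) d"
  have words: "c \<in> words k" "d \<in> words k" and "evaluate \<beta> c = evaluate \<beta> d"
    using cd by (simp_all add: D_ZM_eq[OF length_beta s])
  then have "evaluate inputs c = evaluate inputs d"
    using eq by (simp only: map_append)
  then show "c = d"
    by (rule inj_onD[OF bij_betw_imp_inj_on[OF bij_inputs] _ words])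
next
  fix r assume "r \<in> evaluate (take (k - L) \<alpha>) ` D_ZM k L \<beta> s"
  moreover have "length (take (k - L) \<alpha>) = k - L"
    using length_alpha n_eq L_le by simp
  ultimately show "r \<in> words (k - L)"
    unfolding words_def by (metis (mono_tags) imageE length_map mem_Collect_eq)
next
  fix r :: "'a list" assume r: "r \<in> words (k - L)"
  have "r @ s \<in> evaluate inputs ` words k"
    unfolding bij_betw_imp_surj_on[OF bij_inputs] using r s by (rule append_in_words)
  then obtain c where c: "r @ s = evaluate inputs c" "c \<in> words k"
    by (rule imageE)
  \<comment> \<open>Equal lengths of the right-hand blocks allow the equation of concatenations to
    be split.\<close>
  have "length (evaluate \<beta> c) = length s"
    using s length_beta by (simp add: words_def)
  then have "r = evaluate (take (k - L) \<alpha>) c" and "s = evaluate \<beta> c"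
    using c(1) unfolding map_append
    by (simp_all only: append_eq_append_conv simp_thms)
  moreover from this c(2) have "c \<in> D_ZM k L \<beta> s"
    unfolding D_ZM_eq[OF length_beta s] by simp
  ultimately show "r \<in> evaluate (take (k - L) \<alpha>) ` D_ZM k L \<beta> s"
    by (intro image_eqI)
qed

text \<open>\<open>Poly c\<close> is a witness for the definite description, and injectivity in
  \<open>bij_D_ZM\<close> makes it the only one.\<close>

lemma h_poly_eq:
  assumes s: "s \<in> words L" and c: "c \<in> D_ZM k L \<beta> s"
  shows "h_poly k L \<alpha> \<beta> (evaluate (take (k - L) \<alpha>) c) s = Poly c"
  unfolding h_poly_def
proof (rule the_equality)
  have len: "k - L \<le> length \<alpha>"
    using length_alpha n_eq L_le by simp
  then show "Poly c \<in> Poly ` D_ZM k L \<beta> s \<and>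
      (\<forall>i<k - L. poly (Poly c) (\<alpha> ! i) = evaluate (take (k - L) \<alpha>) c ! i)"
    using c by simp
  fix h
  assume h: "h \<in> Poly ` D_ZM k L \<beta> s \<and>
      (\<forall>i<k - L. poly h (\<alpha> ! i) = evaluate (take (k - L) \<alpha>) c ! i)"
  then obtain d where d: "d \<in> D_ZM k L \<beta> s" "h = Poly d" by blast
  have "evaluate (take (k - L) \<alpha>) d = evaluate (take (k - L) \<alpha>) c"
    using h d len by (intro nth_equalityI) auto
  then show "h = Poly c"
    using bij_betw_imp_inj_on[OF bij_D_ZM[OF s]] c d by (auto dest: inj_onD)
qed

lemma h_poly_outputs:
  assumes r: "r \<in> words (k - L)" and s: "s \<in> words L"
  shows "map (poly (h_poly k L \<alpha> \<beta> r s)) outputs = encode (r @ s)"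
proof -
  obtain c where c: "c \<in> D_ZM k L \<beta> s" "r = evaluate (take (k - L) \<alpha>) c"
    using bij_betw_imp_surj_on[OF bij_D_ZM[OF s]] r by blast
  then show ?thesis
    using h_poly_eq[OF s c(1)] encode_inputs[of c] by (simp add: D_ZM_eq[OF length_beta s])
qed

text \<open>Existence: \<open>permute_qudits k encode\<close> has the prescribed values by
  \<open>h_poly_outputs\<close>. Uniqueness: every word of length \<open>k\<close> splits as
  \<open>r @ s\<close>, so all basis kets have prescribed images.\<close>

lemma U_ZM_enc_eq: "U_ZM_enc k L n \<alpha> \<beta> = permute_qudits k encode"
proof -
  have k: "n - k + L = k"
    using n_eq L_le by simp
  have ket: "tensor (k - L) (ket r) (ket s) = ket (r @ s)" if "r \<in> words (k - L)"
    for r s :: "'a list"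
    using that by (simp add: tensor_ket_ket words_def)
  show ?thesis
    unfolding U_ZM_enc_def k
  proof (rule the_equality)
    show unitary: "unitary_map k k (permute_qudits k encode) \<and>
      (\<forall>r\<in>words (k - L). \<forall>s\<in>words L. permute_qudits k encode (tensor (k - L) (ket r) (ket s)) =
         ket (map (poly (h_poly k L \<alpha> \<beta> r s)) outputs))"
      using unitary_map_permute_qudits[OF bij_encode] permute_qudits_ket[OF bij_encode]
      by (simp add: ket h_poly_outputs append_in_words)
    fix U
    assume U: "unitary_map k k U \<and>
      (\<forall>r\<in>words (k - L). \<forall>s\<in>words L. U (tensor (k - L) (ket r) (ket s)) =
         ket (map (poly (h_poly k L \<alpha> \<beta> r s)) outputs))"
    show "U = permute_qudits k encode"
    proof (rule unitary_map_eqI)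
      fix w :: "'a list" assume w: "w \<in> words k"
      define r s where "r = take (k - L) w" and "s = drop (k - L) w"
      have "r \<in> words (k - L)" "s \<in> words L" "w = r @ s"
        using w L_le by (auto simp: r_def s_def words_def)
      then show "U (ket w) = permute_qudits k encode (ket w)"
        using U unitary ket by metis
    qed (use U unitary in auto)
  qed
qed

lemma U_ZM_enc_ket: "w \<in> words k \<Longrightarrow> U_ZM_enc k L n \<alpha> \<beta> (ket w) = ket (encode w)"
  by (simp add: U_ZM_enc_eq permute_qudits_ket bij_encode)

end

section \<open>Comparison of the two encodings\<close>

text \<open>The vector enters \<open>op_tensor\<close> only through its amplitudes, which are
  multiplied by vectors independent of it; linearity is an exchange of sums.\<close>

lemma op_tensor_scaled_sum:
  "op_tensor m m' l A B (\<lambda>xs. a * (\<Sum>r\<in>R. \<Phi> r xs)) xs = a * (\<Sum>r\<in>R. op_tensor m m' l A B (\<Phi> r) xs)"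
proof -
  have "op_tensor m m' l A B (\<lambda>xs. a * (\<Sum>r\<in>R. \<Phi> r xs)) xs
    = (\<Sum>u\<in>words m. \<Sum>v\<in>words l. \<Sum>r\<in>R. a * (\<Phi> r (u @ v) * tensor m' (A (ket u)) (B (ket v)) xs))"
    by (simp add: op_tensor_def sum_distrib_left sum_distrib_right mult.assoc)
  also have "\<dots> = (\<Sum>u\<in>words m. \<Sum>r\<in>R. \<Sum>v\<in>words l. a * (\<Phi> r (u @ v) * tensor m' (A (ket u)) (B (ket v)) xs))"
    by (intro sum.cong refl sum.swap)
  also have "\<dots> = (\<Sum>r\<in>R. \<Sum>u\<in>words m. \<Sum>v\<in>words l. a * (\<Phi> r (u @ v) * tensor m' (A (ket u)) (B (ket v)) xs))"
    by (rule sum.swap)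
  finally show ?thesis
    by (simp add: op_tensor_def sum_distrib_left)
qed

lemma op_tensor_ket:
  fixes u v :: "'a::finite list"
  assumes u: "u \<in> words m" and v: "v \<in> words l"
  shows "op_tensor m m' l A B (ket (u @ v)) xs = tensor m' (A (ket u)) (B (ket v)) xs"
proof -
  let ?t = "\<lambda>u v. tensor m' (A (ket u)) (B (ket v)) xs"
  have "op_tensor m m' l A B (ket (u @ v)) xs
    = (\<Sum>u'\<in>words m. \<Sum>v'\<in>words l. if u' = u then (if v' = v then ?t u' v' else 0) else 0)"
    \<comment> \<open>All \<open>u'\<close> have the length of \<open>u\<close>, so
      \<open>u' @ v' = u @ v\<close> forces \<open>u' = u\<close> and \<open>v' = v\<close>.\<close>
    unfolding op_tensor_def using u
    by (intro sum.cong refl) (auto simp: ket_apply words_def)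
  also have "\<dots> = (\<Sum>u'\<in>words m. if u' = u then (\<Sum>v'\<in>words l. if v' = v then ?t u' v' else 0) else 0)"
    by (intro sum.cong refl) auto
  also have "\<dots> = ?t u v"
    using u v by simp
  finally show ?thesis .
qed

text \<open>In \<open>r @ r @ s\<close> the first \<open>r\<close> is already distributed as shares,
  while \<open>r @ s\<close> is the word the encoder receives.\<close>

lemma tensor_Psi_ket:
  fixes s :: "'a::{field,finite} list"
  shows "tensor (2 * m) (Psi m) (ket s) =
    (\<lambda>xs. complex_of_real (1 / sqrt (real (CARD('a) ^ m))) * (\<Sum>r\<in>words m. ket (r @ r @ s) xs))"
proof
  fix xs :: "'a list"
  have "tensor (2 * m) (ket (r @ r)) (ket s) xs = ket (r @ r @ s) xs" if "r \<in> words m" for r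
    using that by (subst tensor_ket_ket) (auto simp: words_def)
  moreover have "tensor m (ket r) (ket r) = ket (r @ r)" if "r \<in> words m" for r :: "'a list"
    using that by (simp add: tensor_ket_ket words_def)
  ultimately show "tensor (2 * m) (Psi m) (ket s) xs =
      complex_of_real (1 / sqrt (real (CARD('a) ^ m))) * (\<Sum>r\<in>words m. ket (r @ r @ s) xs)"
    by (simp add: tensor_def[of "2 * m"] Psi_def sum_distrib_right)
qed

theorem theorem9:
  fixes q k L n :: nat
    and \<alpha> \<beta> :: "'a::{field,finite} list"
  assumes "q = CARD('a)"
    and "1 \<le> L" and "L \<le> k" and "n = 2 * k - L" and "n \<le> q - L"
    and "length \<alpha> = n" and "length \<beta> = L" and "distinct (\<alpha> @ \<beta>)"
  shows "\<forall>s\<in>words L. advance_sharing_encoding k L n \<alpha> \<beta> s = original_encoding k L \<alpha> \<beta> s"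
proof (intro ballI ext)
  interpret ramp_points k L n \<alpha> \<beta>
    by standard (fact assms)+
  fix s xs :: "'a list" assume s: "s \<in> words L"
  let ?a = "complex_of_real (1 / sqrt (real (CARD('a) ^ (k - L))))"
  have "op_tensor (k - L) (k - L) k id (U_ZM_enc k L n \<alpha> \<beta>) (ket (r @ r @ s)) xs
      = ket (r @ encode (r @ s)) xs" if r: "r \<in> words (k - L)" for r
  proof -
    have "op_tensor (k - L) (k - L) k id (U_ZM_enc k L n \<alpha> \<beta>) (ket (r @ r @ s)) xs
        = tensor (k - L) (ket r) (ket (encode (r @ s))) xs"
      by (simp only: op_tensor_ket[OF r append_in_words[OF r s]] U_ZM_enc_ket[OF append_in_words[OF r s]] id_apply)
    then show ?thesis
      using r by (simp add: tensor_ket_ket words_def)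
  qed
  then have "advance_sharing_encoding k L n \<alpha> \<beta> s xs
      = ?a * (\<Sum>r\<in>words (k - L). ket (r @ encode (r @ s)) xs)"
    by (simp only: advance_sharing_encoding_def tensor_Psi_ket op_tensor_scaled_sum cong: sum.cong)
  \<comment> \<open>Each \<open>r\<close> is now written as the first \<open>k - L\<close> shares of
    its unique \<open>c\<close>.\<close>
  also have "(\<Sum>r\<in>words (k - L). ket (r @ encode (r @ s)) xs)
      = (\<Sum>c\<in>D_ZM k L \<beta> s. ket (evaluate (take (k - L) \<alpha>) c @ encode (evaluate (take (k - L) \<alpha>) c @ s)) xs)"
    by (rule sum.reindex_bij_betw[OF bij_D_ZM[OF s], symmetric])
  also have "\<dots> = (\<Sum>c\<in>D_ZM k L \<beta> s. ket (evaluate \<alpha> c) xs)"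
  proof (intro sum.cong refl)
    fix c assume "c \<in> D_ZM k L \<beta> s"
    \<comment> \<open>Here \<open>s\<close> is \<open>evaluate \<beta> c\<close>, so the argument of
      \<open>encode\<close> is \<open>evaluate inputs c\<close>.\<close>
    then have "encode (evaluate (take (k - L) \<alpha>) c @ s) = evaluate outputs c"
      using encode_inputs[of c] by (simp add: D_ZM_eq[OF length_beta s])
    then show "ket (evaluate (take (k - L) \<alpha>) c @ encode (evaluate (take (k - L) \<alpha>) c @ s)) xs
        = ket (evaluate \<alpha> c) xs"
      by (simp only: map_append[symmetric] append_take_drop_id)
  qed
  finally show "advance_sharing_encoding k L n \<alpha> \<beta> s xs = original_encoding k L \<alpha> \<beta> s xs"
    by (simp only: original_encoding_def)
qed

end
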